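(* Let $S\subseteq(0,\infty)$ be a dense subsemigroup of both $([0,\infty),+)$ and $([0,\infty),\cdot)$. Let $m,l\in\mathbb{N}$. For each $i\in\{1,\dots,l\}$ let $\langle x_{i,n}\rangle_{n=1}^\infty$ be a sequence in $S$ with $\lim_{n\to\infty}x_{i,n}=0$ and let $p_i\in\bigcap_{r=1}^\infty cl_{\beta S}(FS(\langle x_{i,n}\rangle_{n=r}^\infty))$. Let $f:\{1,\dots,m\}\to\{1,\dots,l\}$ be a function and let $g\in\mathbb{N}[x_1,\dots,x_m]$ be a polynomial with $g(\overline 0)=0$. Then for each $\epsilon>0$, $\{g(\sum_{n\in F_1}x_{f(1),n},\sum_{n\in F_2}x_{f(2),n},\dots,\sum_{n\in F_m}x_{f(m),n}): F_1,\dots,F_m \text{ finite nonempty subsets of }\mathbb{N},\ F_1<F_2<\dots<F_m\}\cap(0,\epsilon)\in g(p_{f(1)},p_{f(2)},\dots,p_{f(m)})$.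
   Context: $\beta S$ is the set of ultrafilters on $S$, $cl_{\beta S}X=\{p:X\in p\}$. $FS(\langle x_n\rangle_{n=r}^\infty)=\{\sum_{n\in F}x_n:F\subseteq\{r,r+1,\dots\}$ finite nonempty$\}$; $F<G$ means $\max F<\min G$. Tensor product: $\otimes_{j=1}^1q_j=q_1$ and $A\in\otimes_{j=1}^{k+1}q_j$ iff $\{(x_1,\dots,x_k):\{x_{k+1}:(x_1,\dots,x_{k+1})\in A\}\in q_{k+1}\}\in\otimes_{j=1}^kq_j$. For $q_1,\dots,q_m\in\beta S$, $g(q_1,\dots,q_m)$ is the evaluation of $g$ at ultrafilters in the sense of Bergelson–Hindman–Williams; it equals $\widetilde g(\otimes_{j=1}^m q_j)$, where $\widetilde g:\beta(S^m)\to\beta S$ is the continuous extension of $g:S^m\to S$.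
   Formalization: Each p_i is also assumed to be near zero (S∩(0,δ) ∈ p_i for all δ>0), and g is nonzero; without the former the claim fails, e.g. 2^k copies of 2^{-k}, p_1 principal at 1, g=x_1. *)

theory Defs
  imports "HOL-Analysis.Analysis" "HOL-Library.Poly_Mapping"
begin

section \<open>Ultrafilters and the space \<open>\<beta>X\<close>\<close>

text \<open>
  An ultrafilter on a set \<open>X\<close> is a family of subsets of \<open>X\<close> (and not of the ambient type), so a
  set belonging to an ultrafilter on \<open>X\<close> is in particular a subset of \<open>X\<close>.
\<close>

definition ultrafilter_on :: "'a set \<Rightarrow> 'a set set \<Rightarrow> bool" where
  "ultrafilter_on X p \<longleftrightarrow>
     p \<subseteq> Pow X \<and> X \<in> p \<and> {} \<notin> p \<and>
     (\<forall>A\<in>p. \<forall>B\<in>p. A \<inter> B \<in> p) \<and>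
     (\<forall>A\<in>p. \<forall>B. A \<subseteq> B \<and> B \<subseteq> X \<longrightarrow> B \<in> p) \<and>
     (\<forall>A. A \<subseteq> X \<longrightarrow> A \<in> p \<or> X - A \<in> p)"

definition beta :: "'a set \<Rightarrow> 'a set set set" where
  "beta X = {p. ultrafilter_on X p}"

definition cl_beta :: "'a set \<Rightarrow> 'a set \<Rightarrow> 'a set set set" where
  "cl_beta X A = {p \<in> beta X. A \<in> p}"

definition beta_topology :: "'a set \<Rightarrow> 'a set set topology" where
  "beta_topology X = topology_generated_by {cl_beta X A |A. A \<subseteq> X}"

definition principal_uf :: "'a set \<Rightarrow> 'a \<Rightarrow> 'a set set" where
  "principal_uf X x = {A. A \<subseteq> X \<and> x \<in> A}"

text \<open>
  The continuous extension \<open>\<beta>X \<rightarrow> \<beta>Y\<close> of \<open>g : X \<rightarrow> Y\<close>, points being identified with principal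
  ultrafilters.  Extensionality pins down the values outside \<open>\<beta>X\<close>; existence and uniqueness are
  shown below in \<open>cont_ext_unique\<close>.
\<close>

definition is_cont_ext ::
    "'a set \<Rightarrow> 'b set \<Rightarrow> ('a \<Rightarrow> 'b) \<Rightarrow> ('a set set \<Rightarrow> 'b set set) \<Rightarrow> bool" where
  "is_cont_ext X Y g h \<longleftrightarrow>
     h \<in> extensional (beta X) \<and>
     continuous_map (beta_topology X) (beta_topology Y) h \<and>
     (\<forall>x\<in>X. h (principal_uf X x) = principal_uf Y (g x))"

definition cont_ext :: "'a set \<Rightarrow> 'b set \<Rightarrow> ('a \<Rightarrow> 'b) \<Rightarrow> 'a set set \<Rightarrow> 'b set set" where
  "cont_ext X Y g = (THE h. is_cont_ext X Y g h)"

lemma topspace_beta_topology: "topspace (beta_topology X) = beta X"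
  unfolding beta_topology_def topology_generated_by_topspace
  by (auto simp: cl_beta_def beta_def ultrafilter_on_def)

lemma openin_cl_beta: "A \<subseteq> X \<Longrightarrow> openin (beta_topology X) (cl_beta X A)"
  unfolding beta_topology_def by (rule topology_generated_by_Basis) auto

lemma principal_uf_in_beta: "x \<in> X \<Longrightarrow> principal_uf X x \<in> beta X"
  by (auto simp: principal_uf_def beta_def ultrafilter_on_def)

lemma cl_beta_mono: "A \<subseteq> B \<Longrightarrow> B \<subseteq> X \<Longrightarrow> cl_beta X A \<subseteq> cl_beta X B"
  unfolding cl_beta_def beta_def ultrafilter_on_def by auto

lemma beta_topology_nbhd:
  assumes "openin (beta_topology X) U" "u \<in> U"
  shows "\<exists>B\<in>u. B \<subseteq> X \<and> cl_beta X B \<subseteq> U"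
proof -
  have "generate_topology_on {cl_beta X A |A. A \<subseteq> X} U"
    using assms(1) unfolding beta_topology_def by (rule openin_topology_generated_by)
  then have "u \<in> beta X \<and> (\<exists>B\<in>u. B \<subseteq> X \<and> cl_beta X B \<subseteq> U)"
    using assms(2)
  proof induction
    case Empty
    then show ?case by simp
  next
    case (Int a b)
    then have ub: "u \<in> beta X" by simp
    from Int obtain B where B: "B \<in> u" "B \<subseteq> X" "cl_beta X B \<subseteq> a" by (meson IntD1)
    from Int obtain C where C: "C \<in> u" "C \<subseteq> X" "cl_beta X C \<subseteq> b" by (meson IntD2)
    have "B \<inter> C \<in> u" using ub B(1) C(1) by (simp add: beta_def ultrafilter_on_def)
    moreover have "cl_beta X (B \<inter> C) \<subseteq> a \<inter> b"
      using cl_beta_mono[of "B \<inter> C" B X] cl_beta_mono[of "B \<inter> C" C X] B C by auto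
    moreover have "B \<inter> C \<subseteq> X" using B(2) by auto
    ultimately show ?case using ub by (intro conjI bexI[of _ "B \<inter> C"])
  next
    case (UN K)
    then obtain k where k: "k \<in> K" "u \<in> k" by auto
    then obtain B where "u \<in> beta X" "B \<in> u" "B \<subseteq> X" "cl_beta X B \<subseteq> k"
      using UN.IH[of k] by auto
    moreover have "k \<subseteq> \<Union>K" using k(1) by auto
    ultimately show ?case by (meson subset_trans)
  next
    case (Basis s)
    then show ?case by (auto simp: cl_beta_def)
  qed
  then show ?thesis by simp
qed

lemma pushforward_in_beta:
  assumes g: "g \<in> X \<rightarrow> Y" and "u \<in> beta X"
  shows "{A. A \<subseteq> Y \<and> {x \<in> X. g x \<in> A} \<in> u} \<in> beta Y"
proof -
  have u: "ultrafilter_on X u" using assms by (simp add: beta_def)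
  have 1: "{x \<in> X. g x \<in> Y} = X" using g by auto
  have 2: "{x \<in> X. g x \<in> A \<and> g x \<in> B} = {x \<in> X. g x \<in> A} \<inter> {x \<in> X. g x \<in> B}" for A B by auto
  have 3: "{x \<in> X. g x \<in> Y \<and> g x \<notin> A} = X - {x \<in> X. g x \<in> A}" for A using g by auto
  have up: "{x \<in> X. g x \<in> B} \<in> u" if "{x \<in> X. g x \<in> A} \<in> u" "A \<subseteq> B" for A B
  proof -
    have "{x \<in> X. g x \<in> A} \<subseteq> {x \<in> X. g x \<in> B}" "{x \<in> X. g x \<in> B} \<subseteq> X" using that by auto
    then show ?thesis using u that(1) unfolding ultrafilter_on_def by blast
  qed
  let ?q = "{A. A \<subseteq> Y \<and> {x \<in> X. g x \<in> A} \<in> u}"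
  have "?q \<subseteq> Pow Y" by auto
  moreover have "Y \<in> ?q" using u by (simp add: 1 ultrafilter_on_def)
  moreover have "{} \<notin> ?q" using u by (simp add: ultrafilter_on_def)
  moreover have "\<forall>A\<in>?q. \<forall>B\<in>?q. A \<inter> B \<in> ?q"
  proof -
    have "\<forall>A\<in>u. \<forall>B\<in>u. A \<inter> B \<in> u" using u by (simp add: ultrafilter_on_def)
    then show ?thesis by (auto simp: 2)
  qed
  moreover have "\<forall>A\<in>?q. \<forall>B. A \<subseteq> B \<and> B \<subseteq> Y \<longrightarrow> B \<in> ?q" using up by blast
  moreover have "\<forall>A. A \<subseteq> Y \<longrightarrow> A \<in> ?q \<or> Y - A \<in> ?q"
  proof -
    have "\<forall>A. A \<subseteq> X \<longrightarrow> A \<in> u \<or> X - A \<in> u" using u by (simp add: ultrafilter_on_def)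
    then have "{x \<in> X. g x \<in> A} \<in> u \<or> X - {x \<in> X. g x \<in> A} \<in> u" for A by auto
    then show ?thesis by (auto simp: 3)
  qed
  ultimately have "ultrafilter_on Y ?q"
    unfolding ultrafilter_on_def by - (intro conjI; assumption)
  then show ?thesis unfolding beta_def by (rule CollectI)
qed

lemma cont_ext_subset:
  assumes h: "is_cont_ext X Y g h1" "is_cont_ext X Y g h2" and u: "u \<in> beta X"
  shows "h2 u \<subseteq> h1 u"
proof (rule ccontr)
  assume "\<not> ?thesis"
  then obtain A where A: "A \<in> h2 u" "A \<notin> h1 u" by auto
  have b: "h1 u \<in> beta Y" "h2 u \<in> beta Y"
    using h u unfolding is_cont_ext_def continuous_map_def topspace_beta_topology by auto
  have "h2 u \<subseteq> Pow Y" "\<And>B. B \<subseteq> Y \<Longrightarrow> B \<in> h1 u \<or> Y - B \<in> h1 u"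
    using b unfolding beta_def ultrafilter_on_def by simp_all
  then have AY: "A \<subseteq> Y" "Y - A \<in> h1 u" using A by (meson PowD subsetD)+
  define U where "U = {v \<in> beta X. h1 v \<in> cl_beta Y (Y - A)} \<inter> {v \<in> beta X. h2 v \<in> cl_beta Y A}"
  have "openin (beta_topology X) {v \<in> beta X. h1 v \<in> cl_beta Y (Y - A)}"
    "openin (beta_topology X) {v \<in> beta X. h2 v \<in> cl_beta Y A}"
    using h openin_cl_beta[of "Y - A" Y] openin_cl_beta[OF AY(1)]
    unfolding is_cont_ext_def continuous_map_def topspace_beta_topology by auto
  then have "openin (beta_topology X) U" unfolding U_def by (rule openin_Int)
  moreover have "u \<in> U" using u b A AY by (auto simp: U_def cl_beta_def)
  ultimately obtain B where B: "B \<in> u" "B \<subseteq> X" "cl_beta X B \<subseteq> U"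
    using beta_topology_nbhd by blast
  have "{} \<notin> u" using u by (simp add: beta_def ultrafilter_on_def)
  then obtain x where x: "x \<in> B" using B(1) by (cases "B = {}") auto
  then have "principal_uf X x \<in> cl_beta X B"
    using B principal_uf_in_beta[of x X] by (auto simp: cl_beta_def principal_uf_def)
  then have "principal_uf X x \<in> U" using B by auto
  moreover have "h1 (principal_uf X x) = principal_uf Y (g x)"
    "h2 (principal_uf X x) = principal_uf Y (g x)"
    using h x B unfolding is_cont_ext_def by auto
  ultimately show False by (auto simp: U_def cl_beta_def principal_uf_def)
qed

lemma is_cont_ext_pushforward:
  assumes g: "g \<in> X \<rightarrow> Y"
  shows "is_cont_ext X Y g (\<lambda>u\<in>beta X. {A. A \<subseteq> Y \<and> {x \<in> X. g x \<in> A} \<in> u})"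
    (is "is_cont_ext X Y g ?P")
  unfolding is_cont_ext_def
proof (intro conjI ballI)
  note P_in = pushforward_in_beta[OF g]
  show "?P \<in> extensional (beta X)" by simp
  show "continuous_map (beta_topology X) (beta_topology Y) ?P"
    unfolding beta_topology_def[of Y]
  proof (rule continuous_on_generated_topo)
    fix U assume "U \<in> {cl_beta Y A |A. A \<subseteq> Y}"
    then obtain A where A: "A \<subseteq> Y" "U = cl_beta Y A" by auto
    have "?P -` U \<inter> topspace (beta_topology X) = cl_beta X {x \<in> X. g x \<in> A}"
      unfolding topspace_beta_topology
      using A P_in by (auto simp: cl_beta_def)
    then show "openin (beta_topology X) (?P -` U \<inter> topspace (beta_topology X))"
      using openin_cl_beta[of "{x \<in> X. g x \<in> A}" X] by auto
  next
    have "\<Union>{cl_beta Y A |A. A \<subseteq> Y} = beta Y"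
      using topspace_beta_topology[of Y] by (simp add: beta_topology_def)
    then show "?P ` topspace (beta_topology X) \<subseteq> \<Union>{cl_beta Y A |A. A \<subseteq> Y}"
      using P_in by (simp add: topspace_beta_topology image_subset_iff)
  qed
next
  fix x assume "x \<in> X"
  then show "?P (principal_uf X x) = principal_uf Y (g x)"
    using principal_uf_in_beta[of x X] by (auto simp: principal_uf_def)
qed

theorem cont_ext_unique:
  assumes g: "g \<in> X \<rightarrow> Y"
  shows "is_cont_ext X Y g h \<longleftrightarrow> h = (\<lambda>u\<in>beta X. {A. A \<subseteq> Y \<and> {x \<in> X. g x \<in> A} \<in> u})"
    (is "_ \<longleftrightarrow> h = ?P")
proof
  assume h: "is_cont_ext X Y g h"
  note P = is_cont_ext_pushforward[OF g]
  show "h = ?P"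
  proof (rule extensionalityI[of _ "beta X"])
    show "h \<in> extensional (beta X)" using h by (simp add: is_cont_ext_def)
    show "?P \<in> extensional (beta X)" by simp
    show "h u = ?P u" if "u \<in> beta X" for u
      using cont_ext_subset[OF h P that] cont_ext_subset[OF P h that] by (rule equalityI[rotated])
  qed
qed (simp only: is_cont_ext_pushforward[OF g])

corollary cont_ext_eq:
  assumes "g \<in> X \<rightarrow> Y" "u \<in> beta X"
  shows "cont_ext X Y g u = {A. A \<subseteq> Y \<and> {x \<in> X. g x \<in> A} \<in> u}"
  unfolding cont_ext_def cont_ext_unique[OF assms(1)] using assms(2) by simp


section \<open>Tensor products\<close>

text \<open>
  A tuple \<open>(x\<^sub>1, \<dots>, x\<^sub>k)\<close> in \<open>S\<^sup>k\<close> is an extensional function on \<open>{1..k}\<close>; \<open>xs(Suc k := y)\<close> is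
  \<open>(x\<^sub>1, \<dots>, x\<^sub>k, y)\<close>.
\<close>

definition tuples :: "'a set \<Rightarrow> nat \<Rightarrow> (nat \<Rightarrow> 'a) set" where
  "tuples S k = {1..k} \<rightarrow>\<^sub>E S"

text \<open>The value at \<open>0\<close> (the only ultrafilter on \<open>S\<^sup>0\<close>) is a convention that is never used.\<close>

fun tensor :: "'a set \<Rightarrow> (nat \<Rightarrow> 'a set set) \<Rightarrow> nat \<Rightarrow> (nat \<Rightarrow> 'a) set set" where
  "tensor S q 0 = {tuples S 0}"
| "tensor S q (Suc 0) =
     {A. A \<subseteq> tuples S 1 \<and> {y \<in> S. (\<lambda>j\<in>{1}. y) \<in> A} \<in> q 1}"
| "tensor S q (Suc (Suc k)) =
     {A. A \<subseteq> tuples S (Suc (Suc k)) \<and>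
         {xs \<in> tuples S (Suc k). {y \<in> S. xs(Suc (Suc k) := y) \<in> A} \<in> q (Suc (Suc k))}
           \<in> tensor S q (Suc k)}"


section \<open>Polynomials with natural coefficients, evaluated at ultrafilters\<close>

text \<open>A monomial maps an index \<open>j\<close> to the exponent of the variable \<open>x\<^sub>j\<close>.\<close>

type_synonym nat_mpoly = "(nat \<Rightarrow>\<^sub>0 nat) \<Rightarrow>\<^sub>0 nat"

definition poly_vars :: "nat_mpoly \<Rightarrow> nat set" where
  "poly_vars g = (\<Union>mon\<in>Poly_Mapping.keys g. Poly_Mapping.keys mon)"

definition poly_eval :: "nat_mpoly \<Rightarrow> (nat \<Rightarrow> real) \<Rightarrow> real" where
  "poly_eval g x =
     (\<Sum>mon\<in>Poly_Mapping.keys g. real (Poly_Mapping.lookup g mon) *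
        (\<Prod>j\<in>Poly_Mapping.keys mon. x j ^ Poly_Mapping.lookup mon j))"

text \<open>\<open>g(q\<^sub>1, \<dots>, q\<^sub>m)\<close>\<close>

definition poly_at_ultrafilters ::
    "real set \<Rightarrow> nat \<Rightarrow> nat_mpoly \<Rightarrow> (nat \<Rightarrow> real set set) \<Rightarrow> real set set" where
  "poly_at_ultrafilters S m g q = cont_ext (tuples S m) S (poly_eval g) (tensor S q m)"


section \<open>Finite sums and ultrafilters near zero\<close>

definition dense_subsemigroup :: "real set \<Rightarrow> bool" where
  "dense_subsemigroup S \<longleftrightarrow>
     S \<subseteq> {0<..} \<and>
     (\<forall>a\<in>S. \<forall>b\<in>S. a + b \<in> S) \<and>
     (\<forall>a\<in>S. \<forall>b\<in>S. a * b \<in> S) \<and>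
     {0..} \<subseteq> closure S"

definition FS :: "(nat \<Rightarrow> real) \<Rightarrow> nat \<Rightarrow> real set" where
  "FS x r = {\<Sum>n\<in>F. x n |F. finite F \<and> F \<noteq> {} \<and> F \<subseteq> {r..}}"

text \<open>
  \<open>0\<^sup>+(S)\<close>, the ultrafilters near zero.  If \<open>x\<close> is a null sequence in \<open>S\<close>, then an ultrafilter
  containing every \<open>FS x r\<close> need not be near zero when \<open>\<Sum>n. x n\<close> diverges: for
  \<open>x = (1/2, 1/2, 1/4, 1/4, 1/4, 1/4, 1/8, \<dots>)\<close> each \<open>FS x r\<close> contains \<open>1\<close>, so the principal
  ultrafilter at \<open>1\<close> contains them all.
\<close>

definition zero_plus :: "real set \<Rightarrow> real set set set" where
  "zero_plus S = {p \<in> beta S. \<forall>\<delta>>0. S \<inter> {0<..<\<delta>} \<in> p}"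

end

theory Submission
  imports Defs
begin

text \<open>
  By induction on the number of factors, the tuples \<open>(\<Sum>n\<in>F\<^sub>1. z\<^sub>1 n, \<dots>, \<Sum>n\<in>F\<^sub>k. z\<^sub>k n)\<close> with
  \<open>F\<^sub>1 < \<dots> < F\<^sub>k\<close> and all entries below \<open>\<delta>\<close> form a member of the tensor product: once
  \<open>F\<^sub>1, \<dots>, F\<^sub>k\<close> are chosen, the admissible next entries include \<open>FS z\<^bsub>k+1\<^esub> r \<inter> (0, \<delta>)\<close> for any
  \<open>r > Max F\<^sub>k\<close>, and this set belongs to the next ultrafilter.  A polynomial without constant term
  is at most \<open>\<delta>\<close> times the sum of its coefficients on tuples with entries in \<open>[0, \<delta>]\<close>,
  \<open>\<delta> \<le> 1\<close>, so for small \<open>\<delta>\<close> it maps these tuples into \<open>(0, \<epsilon>)\<close>.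
\<close>

section \<open>Boolean rules and limits for ultrafilters on a set\<close>

lemma beta_upward:
  assumes "u \<in> beta X" "A \<in> u" "A \<subseteq> B" "B \<subseteq> X"
  shows "B \<in> u"
  using assms unfolding beta_def ultrafilter_on_def by blast

lemma beta_Int:
  assumes "u \<in> beta X" "A \<in> u" "B \<in> u"
  shows "A \<inter> B \<in> u"
  using assms unfolding beta_def ultrafilter_on_def by blast

lemma beta_Int_iff:
  assumes "u \<in> beta X" "A \<subseteq> X" "B \<subseteq> X"
  shows "A \<inter> B \<in> u \<longleftrightarrow> A \<in> u \<and> B \<in> u"
  using assms beta_Int beta_upward by (metis Int_lower1 Int_lower2)

lemma beta_Diff_iff:
  assumes "u \<in> beta X" "A \<subseteq> X"
  shows "X - A \<in> u \<longleftrightarrow> A \<notin> u"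
proof -
  have "{} \<notin> u" "A \<in> u \<or> X - A \<in> u"
    using assms unfolding beta_def ultrafilter_on_def by auto
  then show ?thesis using beta_Int[OF assms(1), of A "X - A"] by auto
qed

lemma betaI:
  assumes "X \<in> u" "{} \<notin> u"
    and "\<And>A B. A \<in> u \<Longrightarrow> B \<in> u \<Longrightarrow> A \<inter> B \<in> u"
    and "\<And>A B. A \<in> u \<Longrightarrow> A \<subseteq> B \<Longrightarrow> B \<subseteq> X \<Longrightarrow> B \<in> u"
    and "\<And>A. A \<subseteq> X \<Longrightarrow> A \<in> u \<or> X - A \<in> u"
    and "u \<subseteq> Pow X"
  shows "u \<in> beta X"
  unfolding beta_def ultrafilter_on_def mem_Collect_eq
  by (intro conjI ballI allI impI) (use assms in simp_all)

text \<open>This is the limit of the family \<open>w\<close> along \<open>u\<close>. Membership in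
  \<open>w x\<close> commutes with intersections and complements because every \<open>w x\<close> is
  an ultrafilter, so each axiom passes from \<open>u\<close> to the limit. The recursive clause of
  \<open>tensor\<close> has this shape.\<close>

lemma beta_limit_in_beta:
  assumes u: "u \<in> beta X" and w: "\<And>x. x \<in> X \<Longrightarrow> w x \<in> beta Z"
  shows "{A. A \<subseteq> Z \<and> {x \<in> X. A \<in> w x} \<in> u} \<in> beta Z" (is "?q \<in> _")
proof -
  have "X \<in> u" "{} \<notin> u" using u by (auto simp: beta_def ultrafilter_on_def)
  moreover have Z: "{x \<in> X. Z \<in> w x} = X" and E: "{x \<in> X. {} \<in> w x} = {}"
    using w by (auto simp: beta_def ultrafilter_on_def)
  ultimately have "Z \<in> ?q" "{} \<notin> ?q" unfolding mem_Collect_eq Z E by simp_all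
  moreover have "A \<inter> B \<in> ?q" if "A \<in> ?q" "B \<in> ?q" for A B
  proof -
    have "{x \<in> X. A \<inter> B \<in> w x} = {x \<in> X. A \<in> w x} \<inter> {x \<in> X. B \<in> w x}"
      using that beta_Int_iff[OF w] by auto
    then show ?thesis using that beta_Int[OF u] by auto
  qed
  moreover have "B \<in> ?q" if "A \<in> ?q" "A \<subseteq> B" "B \<subseteq> Z" for A B
  proof -
    have "{x \<in> X. A \<in> w x} \<subseteq> {x \<in> X. B \<in> w x}"
      using beta_upward[OF w] that by blast
    then show ?thesis using that beta_upward[OF u] by auto
  qed
  moreover have "A \<in> ?q \<or> Z - A \<in> ?q" if "A \<subseteq> Z" for A
  proof -
    have "{x \<in> X. Z - A \<in> w x} = X - {x \<in> X. A \<in> w x}"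
      using beta_Diff_iff[OF w that] by auto
    then show ?thesis using that beta_Diff_iff[OF u, of "{x \<in> X. A \<in> w x}"] by auto
  qed
  moreover have "?q \<subseteq> Pow Z" by auto
  ultimately show ?thesis by (rule betaI)
qed

section \<open>Tensor products as ultrafilters\<close>

lemma singleton_in_tuples: "y \<in> S \<Longrightarrow> (\<lambda>j\<in>{1}. y) \<in> tuples S (Suc 0)"
  by (auto simp: tuples_def)

lemma fun_upd_in_tuples:
  assumes "xs \<in> tuples S k" "y \<in> S"
  shows "xs(Suc k := y) \<in> tuples S (Suc k)"
  using PiE_fun_upd[OF assms(2) assms(1)[unfolded tuples_def], where x = "Suc k"]
  by (simp add: tuples_def atLeastAtMostSuc_conv)

text \<open>Needed to pass to supersets inside a tensor product and to apply
  \<open>cont_ext_eq\<close>.\<close>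

lemma tensor_in_beta:
  assumes "\<And>j. j \<in> {1..Suc k} \<Longrightarrow> q j \<in> beta S"
  shows "tensor S q (Suc k) \<in> beta (tuples S (Suc k))"
  using assms
proof (induction k)
  case 0
  show ?case
    using pushforward_in_beta[of "\<lambda>y. \<lambda>j\<in>{1}. y" S "tuples S 1" "q 1"] 0
      funcsetI[of S "\<lambda>y. \<lambda>j\<in>{1}. y" "tuples S 1", OF singleton_in_tuples[folded One_nat_def]]
    by simp
next
  case (Suc k)
  let ?k = "Suc k" and ?T = "tuples S (Suc (Suc k))"
  \<comment> \<open>\<open>w xs\<close> is the push-forward of the last factor to the fibre over
    \<open>xs\<close>; the next tensor product is the limit of these along the previous one.\<close>
  define w where "w xs = {A. A \<subseteq> ?T \<and> {y \<in> S. xs(Suc ?k := y) \<in> A} \<in> q (Suc ?k)}" for xs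
  have "w xs \<in> beta ?T" if "xs \<in> tuples S ?k" for xs
    unfolding w_def using Suc.prems that fun_upd_in_tuples
    by (intro pushforward_in_beta) auto
  moreover have "tensor S q ?k \<in> beta (tuples S ?k)" using Suc by simp
  ultimately have "{A. A \<subseteq> ?T \<and> {xs \<in> tuples S ?k. A \<in> w xs} \<in> tensor S q ?k} \<in> beta ?T"
    by (rule beta_limit_in_beta[rotated])
  moreover have "{A. A \<subseteq> ?T \<and> {xs \<in> tuples S ?k. A \<in> w xs} \<in> tensor S q ?k} =
      tensor S q (Suc ?k)"
    by (auto simp: w_def)
  ultimately show ?case by simp
qed

section \<open>Tuples of small block sums\<close>

text \<open>No lower bound on the entries is imposed: they lie in \<open>S\<close>, which is
  positive in the application. \<open>F\<close> is a total function so that a further block can be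
  added by an update.\<close>

definition small_block_sums ::
    "real set \<Rightarrow> (nat \<Rightarrow> nat \<Rightarrow> real) \<Rightarrow> real \<Rightarrow> nat \<Rightarrow> (nat \<Rightarrow> real) set" where
  "small_block_sums S z \<delta> k =
     {xs \<in> tuples S k. (\<forall>j\<in>{1..k}. xs j < \<delta>) \<and>
        (\<exists>F :: nat \<Rightarrow> nat set.
           (\<forall>j\<in>{1..k}. finite (F j) \<and> F j \<noteq> {} \<and> F j \<subseteq> {1..} \<and> xs j = (\<Sum>n\<in>F j. z j n)) \<and>
           (\<forall>j\<in>{1..<k}. Max (F j) < Min (F (Suc j))))}"

lemma small_block_sums_subset: "small_block_sums S z \<delta> k \<subseteq> tuples S k"
  by (auto simp: small_block_sums_def)

text \<open>The threshold \<open>r\<close> varies with \<open>xs\<close>. The tensor product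
  tolerates this, since each fibre is tested separately; it is the reason for requiring
  \<open>FS\<close> sets with arbitrarily late starting index.\<close>

lemma small_block_sums_extend:
  assumes xs: "xs \<in> small_block_sums S z \<delta> k" and k: "k \<ge> 1"
  shows "\<exists>r\<ge>1. \<forall>y \<in> FS (z (Suc k)) r \<inter> (S \<inter> {0<..<\<delta>}). xs(Suc k := y) \<in> small_block_sums S z \<delta> (Suc k)"
proof -
  obtain F :: "nat \<Rightarrow> nat set" where
    F: "\<forall>j\<in>{1..k}. finite (F j) \<and> F j \<noteq> {} \<and> F j \<subseteq> {1..} \<and> xs j = (\<Sum>n\<in>F j. z j n)"
    and lt: "\<forall>j\<in>{1..<k}. Max (F j) < Min (F (Suc j))"
    using xs unfolding small_block_sums_def by blast
  have xsT: "xs \<in> tuples S k" "\<And>j. j \<in> {1..k} \<Longrightarrow> xs j < \<delta>"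
    using xs by (auto simp: small_block_sums_def)
  \<comment> \<open>Starting at \<open>Suc (Max (F k))\<close> puts the new block strictly after
    \<open>F k\<close> and keeps its indices at least 1.\<close>
  have "xs(Suc k := y) \<in> small_block_sums S z \<delta> (Suc k)"
    if y: "y \<in> FS (z (Suc k)) (Suc (Max (F k)))" "y \<in> S" "y < \<delta>" for y
  proof -
    obtain G where G: "y = (\<Sum>n\<in>G. z (Suc k) n)" "finite G" "G \<noteq> {}" "G \<subseteq> {Suc (Max (F k))..}"
      using y(1) unfolding FS_def by blast
    have "Min G \<in> {Suc (Max (F k))..}" using G Min_in by blast
    then have "Max (F k) < Min G" by simp
    \<comment> \<open>Only the inequality at \<open>j = k\<close> is new; the earlier blocks are
      untouched.\<close>
    then have "Max ((F(Suc k := G)) j) < Min ((F(Suc k := G)) (Suc j))" if "j \<in> {1..<Suc k}" for j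
      using that lt by (cases "j = k") auto
    moreover have "finite ((F(Suc k := G)) j) \<and> (F(Suc k := G)) j \<noteq> {} \<and> (F(Suc k := G)) j \<subseteq> {1..} \<and>
        (xs(Suc k := y)) j = (\<Sum>n\<in>(F(Suc k := G)) j. z j n)" if "j \<in> {1..Suc k}" for j
    proof (cases "j = Suc k")
      case True
      then show ?thesis using G by auto
    next
      case False
      then show ?thesis using F that by simp
    qed
    moreover have "(xs(Suc k := y)) j < \<delta>" if "j \<in> {1..Suc k}" for j
      using that xsT(2)[of j] y(3) by auto
    ultimately show ?thesis
      unfolding small_block_sums_def mem_Collect_eq using fun_upd_in_tuples[OF xsT(1) y(2)]
      by (intro conjI exI[of _ "F(Suc k := G)"] ballI) simp_all
  qed
  then show ?thesis by (intro exI[of _ "Suc (Max (F k))"]) auto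
qed

lemma small_block_sums_in_tensor:
  assumes "\<delta> > 0"
    and "\<And>j. j \<in> {1..Suc k} \<Longrightarrow> q j \<in> zero_plus S"
    and "\<And>j r. j \<in> {1..Suc k} \<Longrightarrow> r \<ge> 1 \<Longrightarrow> FS (z j) r \<in> q j"
  shows "small_block_sums S z \<delta> (Suc k) \<in> tensor S q (Suc k)"
  using assms(2,3)
proof (induction k)
  case 0
  have q: "q 1 \<in> beta S" "S \<inter> {0<..<\<delta>} \<in> q 1" "FS (z 1) 1 \<in> q 1"
    using 0 \<open>\<delta> > 0\<close> by (auto simp: zero_plus_def)
  \<comment> \<open>With a single block there is nothing to compare, so \<open>r = 1\<close>
    suffices and a constant family of blocks is a witness.\<close>
  have "(\<lambda>j\<in>{1}. y) \<in> small_block_sums S z \<delta> (Suc 0)" if y: "y \<in> FS (z 1) 1 \<inter> (S \<inter> {0<..<\<delta>})" for y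
  proof -
    obtain G where "y = (\<Sum>n\<in>G. z 1 n)" "finite G" "G \<noteq> {}" "G \<subseteq> {1..}"
      using y unfolding FS_def by blast
    then show ?thesis
      unfolding small_block_sums_def using y singleton_in_tuples[of y S]
      by (auto intro!: exI[of _ "\<lambda>_. G"])
  qed
  then have "FS (z 1) 1 \<inter> (S \<inter> {0<..<\<delta>}) \<subseteq> {y \<in> S. (\<lambda>j\<in>{1}. y) \<in> small_block_sums S z \<delta> (Suc 0)}"
    by blast
  then have "{y \<in> S. (\<lambda>j\<in>{1}. y) \<in> small_block_sums S z \<delta> (Suc 0)} \<in> q 1"
    using beta_upward[OF q(1) beta_Int[OF q(1) q(3) q(2)]] by blast
  then show ?case using small_block_sums_subset[of S z \<delta> 1] by simp
next
  case (Suc k)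
  let ?k = "Suc k" and ?B = "small_block_sums S z \<delta>"
  have q: "q (Suc ?k) \<in> beta S" "S \<inter> {0<..<\<delta>} \<in> q (Suc ?k)"
    "\<And>r. r \<ge> 1 \<Longrightarrow> FS (z (Suc ?k)) r \<in> q (Suc ?k)"
    using Suc.prems \<open>\<delta> > 0\<close> by (auto simp: zero_plus_def)
  have "{y \<in> S. xs(Suc ?k := y) \<in> ?B (Suc ?k)} \<in> q (Suc ?k)" if xs: "xs \<in> ?B ?k" for xs
  proof -
    obtain r where r: "r \<ge> 1"
      "\<forall>y \<in> FS (z (Suc ?k)) r \<inter> (S \<inter> {0<..<\<delta>}). xs(Suc ?k := y) \<in> ?B (Suc ?k)"
      using small_block_sums_extend[OF xs] by auto
    then have "FS (z (Suc ?k)) r \<inter> (S \<inter> {0<..<\<delta>}) \<subseteq> {y \<in> S. xs(Suc ?k := y) \<in> ?B (Suc ?k)}"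
      by blast
    then show ?thesis
      using beta_upward[OF q(1) beta_Int[OF q(1) q(3)[OF r(1)] q(2)]] by blast
  qed
  \<comment> \<open>The prefixes whose fibre is large include all of \<open>?B ?k\<close>, which the
    induction hypothesis places in the tensor product.\<close>
  then have "?B ?k \<subseteq> {xs \<in> tuples S ?k. {y \<in> S. xs(Suc ?k := y) \<in> ?B (Suc ?k)} \<in> q (Suc ?k)}"
    using small_block_sums_subset by blast
  moreover have "?B ?k \<in> tensor S q ?k" using Suc by simp
  moreover have "tensor S q ?k \<in> beta (tuples S ?k)"
    using Suc.prems by (intro tensor_in_beta) (auto simp: zero_plus_def)
  ultimately have "{xs \<in> tuples S ?k. {y \<in> S. xs(Suc ?k := y) \<in> ?B (Suc ?k)} \<in> q (Suc ?k)} \<in> tensor S q ?k"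
    using beta_upward by blast
  then show ?case using small_block_sums_subset by simp
qed

section \<open>Polynomials without constant term: values in \<open>S\<close> and bounds near
  zero\<close>

lemma sum_in_additive:
  assumes "\<And>a b. a \<in> S \<Longrightarrow> b \<in> S \<Longrightarrow> a + b \<in> S" "finite I" "I \<noteq> {}" "\<And>i. i \<in> I \<Longrightarrow> h i \<in> S"
  shows "sum h I \<in> S"
  using assms(2-4) by (induction I rule: finite_ne_induct) (auto intro: assms(1))

lemma prod_in_multiplicative:
  assumes "\<And>a b. a \<in> S \<Longrightarrow> b \<in> S \<Longrightarrow> a * b \<in> S" "finite I" "I \<noteq> {}" "\<And>i. i \<in> I \<Longrightarrow> h i \<in> S"
  shows "prod h I \<in> S"
  using assms(2-4) by (induction I rule: finite_ne_induct) (auto intro: assms(1))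

lemma poly_eval_cong:
  assumes "\<And>j. j \<in> poly_vars g \<Longrightarrow> a j = b j"
  shows "poly_eval g a = poly_eval g b"
proof -
  have "(\<Prod>j\<in>Poly_Mapping.keys mon. a j ^ Poly_Mapping.lookup mon j) =
      (\<Prod>j\<in>Poly_Mapping.keys mon. b j ^ Poly_Mapping.lookup mon j)"
    if "mon \<in> Poly_Mapping.keys g" for mon
    using that by (intro prod.cong refl arg_cong[where f = "\<lambda>t. t ^ _"] assms)
      (auto simp: poly_vars_def)
  then show ?thesis unfolding poly_eval_def by (intro sum.cong refl) simp
qed

text \<open>Natural coefficients cannot cancel, so the value at the origin is at least the constant
  term, whose empty product of variables is 1.\<close>

lemma zero_notin_keys:
  assumes "poly_eval g (\<lambda>_. 0) = 0"
  shows "0 \<notin> Poly_Mapping.keys g"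
proof
  assume 0: "0 \<in> Poly_Mapping.keys g"
  let ?t = "\<lambda>mon. real (Poly_Mapping.lookup g mon) *
        (\<Prod>j\<in>Poly_Mapping.keys mon. 0 ^ Poly_Mapping.lookup mon j)"
  have "?t 0 \<le> poly_eval g (\<lambda>_. 0)"
    unfolding poly_eval_def using 0 by (intro member_le_sum) (auto intro!: mult_nonneg_nonneg prod_nonneg)
  moreover have "?t 0 > 0" using 0 by (simp add: in_keys_iff)
  ultimately show False using assms by simp
qed

text \<open>\<open>S\<close> omits 0 and may omit 1, so empty sums and products must be excluded:
  \<open>g \<noteq> 0\<close> makes the sum over monomials nonempty, and the absence of the zero
  monomial does so for each product of variables.\<close>

lemma poly_eval_in_subsemigroup:
  assumes S: "dense_subsemigroup S"
    and g: "g \<noteq> 0" "0 \<notin> Poly_Mapping.keys g" and a: "\<And>j. j \<in> poly_vars g \<Longrightarrow> a j \<in> S"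
  shows "poly_eval g a \<in> S"
proof -
  have add: "\<And>a b. a \<in> S \<Longrightarrow> b \<in> S \<Longrightarrow> a + b \<in> S" and mult: "\<And>a b. a \<in> S \<Longrightarrow> b \<in> S \<Longrightarrow> a * b \<in> S"
    using S unfolding dense_subsemigroup_def by auto
  show ?thesis
    unfolding poly_eval_def
  proof (rule sum_in_additive[OF add])
    fix mon assume mon: "mon \<in> Poly_Mapping.keys g"
    then have "mon \<noteq> 0" using g(2) by auto
    have "a j ^ Poly_Mapping.lookup mon j \<in> S" if j: "j \<in> Poly_Mapping.keys mon" for j
    proof -
      have "a j \<in> S" using j mon by (intro a) (auto simp: poly_vars_def)
      \<comment> \<open>A power is a product of equal factors, nonempty because exponents on
        \<open>keys\<close> are nonzero. The coefficient is handled likewise below, as a repeated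
        sum.\<close>
      then have "(\<Prod>i<Poly_Mapping.lookup mon j. a j) \<in> S"
        using j by (intro prod_in_multiplicative[OF mult]) (auto simp: in_keys_iff lessThan_empty_iff)
      then show ?thesis by simp
    qed
    then have "(\<Prod>j\<in>Poly_Mapping.keys mon. a j ^ Poly_Mapping.lookup mon j) \<in> S" (is "?P \<in> S")
      using \<open>mon \<noteq> 0\<close> by (intro prod_in_multiplicative[OF mult]) auto
    then have "(\<Sum>i<Poly_Mapping.lookup g mon. ?P) \<in> S"
      using mon by (intro sum_in_additive[OF add]) (auto simp: in_keys_iff lessThan_empty_iff)
    then show "real (Poly_Mapping.lookup g mon) * ?P \<in> S" by simp
  qed (use g in auto)
qed

text \<open>In each monomial one factor is bounded by \<delta> and all the others by 1.\<close>

lemma poly_eval_le: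
  assumes g: "0 \<notin> Poly_Mapping.keys g" and \<delta>: "\<delta> \<le> 1"
    and a: "\<And>j. j \<in> poly_vars g \<Longrightarrow> 0 \<le> a j \<and> a j \<le> \<delta>"
  shows "poly_eval g a \<le> \<delta> * (\<Sum>mon\<in>Poly_Mapping.keys g. real (Poly_Mapping.lookup g mon))"
  unfolding poly_eval_def sum_distrib_left
proof (rule sum_mono)
  fix mon assume mon: "mon \<in> Poly_Mapping.keys g"
  let ?h = "\<lambda>j. a j ^ Poly_Mapping.lookup mon j"
  have a': "0 \<le> a j" "a j \<le> \<delta>" if "j \<in> Poly_Mapping.keys mon" for j
    using a[of j] mon that by (auto simp: poly_vars_def)
  have h: "0 \<le> ?h j" "?h j \<le> \<delta>" "?h j \<le> 1" if j: "j \<in> Poly_Mapping.keys mon" for j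
  proof -
    have "?h j \<le> a j ^ 1"
      using a'[OF j] \<delta> j by (intro power_decreasing) (auto simp: in_keys_iff)
    then show "0 \<le> ?h j" "?h j \<le> \<delta>" "?h j \<le> 1" using a'[OF j] \<delta> by auto
  qed
  have "Poly_Mapping.keys mon \<noteq> {}" using mon g by auto
  then obtain i where i: "i \<in> Poly_Mapping.keys mon" by blast
  have "prod ?h (Poly_Mapping.keys mon) = ?h i * prod ?h (Poly_Mapping.keys mon - {i})"
    using i by (simp add: prod.remove)
  also have "\<dots> \<le> ?h i * 1"
    using h i by (intro mult_left_mono prod_le_1) auto
  also have "\<dots> \<le> \<delta>" using h(2)[OF i] by simp
  finally show "real (Poly_Mapping.lookup g mon) * prod ?h (Poly_Mapping.keys mon) \<le>
      \<delta> * real (Poly_Mapping.lookup g mon)"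
    by (simp add: mult.commute[of \<delta>] mult_left_mono)
qed

lemma poly_eval_small:
  assumes "0 \<notin> Poly_Mapping.keys g" "\<epsilon> > 0"
  obtains \<delta> where "\<delta> > 0" "\<And>a. (\<And>j. j \<in> poly_vars g \<Longrightarrow> 0 \<le> a j \<and> a j \<le> \<delta>) \<Longrightarrow> poly_eval g a < \<epsilon>"
proof -
  let ?C = "\<Sum>mon\<in>Poly_Mapping.keys g. real (Poly_Mapping.lookup g mon)"
  \<comment> \<open>The minimum with 1 is what \<open>poly_eval_le\<close> requires. The
    \<open>+ 1\<close> keeps the denominator positive when \<open>?C = 0\<close> and makes the bound
    strict: \<open>\<delta> * ?C \<le> \<epsilon> - \<delta>\<close>.\<close>
  define \<delta> where "\<delta> = min 1 (\<epsilon> / (?C + 1))"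
  have C: "?C \<ge> 0" by (simp add: sum_nonneg)
  then have "\<delta> > 0" "\<delta> \<le> 1" "\<delta> \<le> \<epsilon> / (?C + 1)" using \<open>\<epsilon> > 0\<close> by (auto simp: \<delta>_def)
  moreover from this have "\<delta> * (?C + 1) \<le> \<epsilon>" using C by (simp add: pos_le_divide_eq)
  ultimately have "\<delta> * ?C < \<epsilon>" by (simp add: distrib_left)
  then show ?thesis
    by (intro that[OF \<open>\<delta> > 0\<close>] le_less_trans[OF poly_eval_le[OF assms(1) \<open>\<delta> \<le> 1\<close>]])
qed

text \<open>For \<open>g = 0\<close> the only value is 0, which is not in \<open>S\<close>, so
  \<open>poly_eval g\<close> would not map tuples into \<open>S\<close>. Comparing consecutive
  blocks orders all of them, since \<open>Min \<le> Max\<close> on a nonempty finite set. The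
  \<open>zero_plus\<close> hypothesis supplies entries below any given bound.\<close>

theorem theorem4p10:
  fixes S :: "real set" and m l :: nat
    and x :: "nat \<Rightarrow> nat \<Rightarrow> real" and p :: "nat \<Rightarrow> real set set"
    and f :: "nat \<Rightarrow> nat" and g :: nat_mpoly and \<epsilon> :: real
  assumes "dense_subsemigroup S"
    and "m \<ge> 1" and "l \<ge> 1"
    and "\<And>i n. i \<in> {1..l} \<Longrightarrow> n \<ge> 1 \<Longrightarrow> x i n \<in> S"
    and "\<And>i. i \<in> {1..l} \<Longrightarrow> x i \<longlonglongrightarrow> 0"
    and "\<And>i. i \<in> {1..l} \<Longrightarrow> p i \<in> (\<Inter>r\<in>{1..}. cl_beta S (FS (x i) r))"
    and "\<And>i. i \<in> {1..l} \<Longrightarrow> p i \<in> zero_plus S"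
    and "f \<in> {1..m} \<rightarrow> {1..l}"
    and "poly_vars g \<subseteq> {1..m}" and "g \<noteq> 0" and "poly_eval g (\<lambda>_. 0) = 0"
    and "\<epsilon> > 0"
  shows "{poly_eval g (\<lambda>j. \<Sum>n\<in>F j. x (f j) n) |F :: nat \<Rightarrow> nat set.
            (\<forall>j\<in>{1..m}. finite (F j) \<and> F j \<noteq> {} \<and> F j \<subseteq> {1..}) \<and>
            (\<forall>j\<in>{1..<m}. Max (F j) < Min (F (Suc j)))} \<inter> {0<..<\<epsilon>}
         \<in> poly_at_ultrafilters S m g (\<lambda>j. p (f j))"
    (is "?A \<inter> _ \<in> _")
proof -
  let ?q = "\<lambda>j. p (f j)" and ?z = "\<lambda>j. x (f j)" and ?T = "tuples S m"
  have f: "f j \<in> {1..l}" if "j \<in> {1..m}" for j using assms(8) that by auto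
  have pos: "s > 0" if "s \<in> S" for s using assms(1) that by (auto simp: dense_subsemigroup_def)
  have add: "a + b \<in> S" if "a \<in> S" "b \<in> S" for a b
    using assms(1) that by (auto simp: dense_subsemigroup_def)
  have g0: "0 \<notin> Poly_Mapping.keys g" by (rule zero_notin_keys[OF assms(11)])
  obtain \<delta> where \<delta>: "\<delta> > 0"
    "\<And>a. (\<And>j. j \<in> poly_vars g \<Longrightarrow> 0 \<le> a j \<and> a j \<le> \<delta>) \<Longrightarrow> poly_eval g a < \<epsilon>"
    using poly_eval_small[OF g0 \<open>\<epsilon> > 0\<close>] by blast
  obtain k where m: "m = Suc k" using assms(2) by (cases m) auto
  have eval_S: "poly_eval g a \<in> S" if "\<And>j. j \<in> {1..m} \<Longrightarrow> a j \<in> S" for a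
    using that assms(9) by (intro poly_eval_in_subsemigroup[OF assms(1,10) g0]) auto
  have tensor: "tensor S ?q m \<in> beta ?T"
    unfolding m using assms(7) f m by (intro tensor_in_beta) (auto simp: zero_plus_def)
  have block: "small_block_sums S ?z \<delta> m \<in> tensor S ?q m"
    unfolding m using \<delta>(1) assms(6,7) f m
    by (intro small_block_sums_in_tensor) (auto simp: cl_beta_def)
  have "xs \<in> {xs \<in> ?T. poly_eval g xs \<in> ?A \<inter> {0<..<\<epsilon>}}" if xs: "xs \<in> small_block_sums S ?z \<delta> m" for xs
  proof -
    have xsT: "xs \<in> ?T" and lt: "\<And>j. j \<in> {1..m} \<Longrightarrow> xs j < \<delta>"
      using xs by (auto simp: small_block_sums_def)
    obtain F :: "nat \<Rightarrow> nat set" where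
      F: "\<forall>j\<in>{1..m}. finite (F j) \<and> F j \<noteq> {} \<and> F j \<subseteq> {1..} \<and> xs j = (\<Sum>n\<in>F j. ?z j n)"
        "\<forall>j\<in>{1..<m}. Max (F j) < Min (F (Suc j))"
      using xs unfolding small_block_sums_def by blast
    have xsS: "xs j \<in> S" if "j \<in> {1..m}" for j using xsT that by (auto simp: tuples_def)
    \<comment> \<open>Outside \<open>{1..m}\<close> the tuple \<open>xs\<close> is
      \<open>undefined\<close>; agreement on the variables of \<open>g\<close> is enough.\<close>
    have "poly_eval g xs = poly_eval g (\<lambda>j. \<Sum>n\<in>F j. ?z j n)"
      using F(1) assms(9) by (intro poly_eval_cong) auto
    then have "poly_eval g xs \<in> ?A" using F by blast
    moreover have "poly_eval g xs < \<epsilon>"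
    proof (rule \<delta>(2))
      fix j assume "j \<in> poly_vars g"
      then have "j \<in> {1..m}" using assms(9) by blast
      then show "0 \<le> xs j \<and> xs j \<le> \<delta>" using pos[OF xsS] lt by (simp add: less_imp_le)
    qed
    moreover have "poly_eval g xs > 0" by (intro pos eval_S xsS)
    ultimately show ?thesis using xsT by simp
  qed
  then have "{xs \<in> ?T. poly_eval g xs \<in> ?A \<inter> {0<..<\<epsilon>}} \<in> tensor S ?q m"
    by (intro beta_upward[OF tensor block]) auto
  \<comment> \<open>An ultrafilter on \<open>S\<close> contains only subsets of \<open>S\<close>, so
    a large preimage alone does not give membership.\<close>
  moreover have "?A \<subseteq> S"
  proof
    fix s assume "s \<in> ?A"
    then obtain F :: "nat \<Rightarrow> nat set" where s: "s = poly_eval g (\<lambda>j. \<Sum>n\<in>F j. ?z j n)"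
      and F: "\<And>j. j \<in> {1..m} \<Longrightarrow> finite (F j) \<and> F j \<noteq> {} \<and> F j \<subseteq> {1..}"
      by blast
    have "(\<Sum>n\<in>F j. ?z j n) \<in> S" if "j \<in> {1..m}" for j
      using F[OF that] by (intro sum_in_additive[OF add]) (auto intro!: assms(4) f that)
    then show "s \<in> S" unfolding s by (rule eval_S)
  qed
  moreover have "poly_eval g \<in> ?T \<rightarrow> S"
    unfolding tuples_def by (intro funcsetI eval_S) auto
  \<comment> \<open>By \<open>cont_ext_eq\<close> the continuous extension acts as push-forward, so
    the claim is membership of the preimage in the tensor product.\<close>
  ultimately show ?thesis
    unfolding poly_at_ultrafilters_def by (subst cont_ext_eq[OF _ tensor]) auto
qed

end
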